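(* Let $\phi$ be a Boolean formula in variables $y_1,\dots,y_m$ such that the Hamming distance between any two distinct models of $\phi$ is at least $d\ge1$, let $s\ge1$ be an integer, $\beta>0$, $\lambda\in(0,\tfrac12]$, and suppose $\#\phi>2^{s+\beta}$. Let $c_1,\dots,c_s$ be XOR constraints drawn independently from the distribution below, $\chi_s=\phi\wedge c_1\wedge\cdots\wedge c_s$, $T_s=\#\chi_s$ and $\mu_s=E[T_s]$. Then $\dfrac{\mathrm{var}(T_s)}{\mu_s^2}\le B(s,m,\beta,d,\lambda)$.
   Context: $\#\psi$ is the number of models of $\psi$. An XOR constraint on $y_1,\dots,y_m$ is an equation $a_0=a_1y_1\oplus\cdots\oplus a_my_m$; constraints are drawn with $a_0$ uniform in $\{0,1\}$ and each $a_i$ ($i\ge1$) equal to $1$ independently with probability $\lambda$. Let $\rho=1-2\lambda$ and $N=\lceil 2^{s+\beta}\rceil$. For $j=d,\dots,m$: $l_j=j-\lceil d/2\rceil+1$ if $j\le m/2$, and $l_j=\max\{0,m-j-\lceil d/2\rceil+1\}$ if $j>m/2$; $w^*=\min\{w:d\le w\le m,\ \sum_{j=d}^w\binom{m}{l_j}\ge N-1\}$ (with $\min\emptyset=0$); $N^*=\sum_{j=d}^{w^*-1}\binom{m}{l_j}$. Then $$B(s,m,\beta,d,\lambda)=2^{-\beta}+2^{-s-\beta}\left(\sum_{j=d}^{w^*-1}\binom{m}{l_j}(1+\rho^j)^s+(N-1-N^* )(1+\rho^{w^*})^s\right)-1.$$ *)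

theory Defs
  imports "HOL-Probability.Probability"
begin

datatype (vars: 'v) formula =
    Const bool
  | Var 'v
  | Neg "'v formula"
  | Conj "'v formula" "'v formula"
  | Disj "'v formula" "'v formula"
  | Impl "'v formula" "'v formula"
  | Iff "'v formula" "'v formula"
  | Xor "'v formula" "'v formula"

primrec holds :: "('v \<Rightarrow> bool) \<Rightarrow> 'v formula \<Rightarrow> bool" where
  "holds v (Const b) = b"
| "holds v (Var x) = v x"
| "holds v (Neg p) = (\<not> holds v p)"
| "holds v (Conj p q) = (holds v p \<and> holds v q)"
| "holds v (Disj p q) = (holds v p \<or> holds v q)"
| "holds v (Impl p q) = (holds v p \<longrightarrow> holds v q)"
| "holds v (Iff p q) = (holds v p \<longleftrightarrow> holds v q)"
| "holds v (Xor p q) = (holds v p \<noteq> holds v q)"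

text \<open>The variables are \<open>1, \<dots>, m\<close>. Assignments are extensional functions on this index set,
  so that there are exactly \<open>2 ^ m\<close> of them.\<close>

definition models :: "nat \<Rightarrow> nat formula \<Rightarrow> (nat \<Rightarrow> bool) set" where
  "models m p = {v \<in> {1..m} \<rightarrow>\<^sub>E UNIV. holds v p}"

definition num_models :: "nat \<Rightarrow> nat formula \<Rightarrow> nat" where
  "num_models m p = card (models m p)"

definition hamming_dist :: "nat \<Rightarrow> (nat \<Rightarrow> bool) \<Rightarrow> (nat \<Rightarrow> bool) \<Rightarrow> nat" where
  "hamming_dist m u v = card {i \<in> {1..m}. u i \<noteq> v i}"

text \<open>The coefficients \<open>a 0, \<dots>, a m\<close> encode the constraint
  \<open>a 0 = a 1 y\<^sub>1 \<oplus> \<dots> \<oplus> a m y\<^sub>m\<close>.\<close>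

definition xor_constraint :: "nat \<Rightarrow> (nat \<Rightarrow> bool) \<Rightarrow> nat formula" where
  "xor_constraint m a =
     Iff (Const (a 0)) (foldr Xor (map (\<lambda>i. Conj (Const (a i)) (Var i)) [1..<Suc m]) (Const False))"

definition xor_coeffs_pmf :: "nat \<Rightarrow> real \<Rightarrow> (nat \<Rightarrow> bool) pmf" where
  "xor_coeffs_pmf m lam =
     Pi_pmf {0..m} False (\<lambda>i. if i = 0 then bernoulli_pmf (1 / 2) else bernoulli_pmf lam)"

definition constraints_pmf :: "nat \<Rightarrow> nat \<Rightarrow> real \<Rightarrow> (nat \<Rightarrow> nat formula) pmf" where
  "constraints_pmf s m lam =
     Pi_pmf {1..s} (Const True) (\<lambda>_. map_pmf (xor_constraint m) (xor_coeffs_pmf m lam))"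

definition conj_constraints :: "nat \<Rightarrow> nat formula \<Rightarrow> (nat \<Rightarrow> nat formula) \<Rightarrow> nat formula" where
  "conj_constraints s p c = foldl Conj p (map c [1..<Suc s])"

definition l_idx :: "nat \<Rightarrow> nat \<Rightarrow> nat \<Rightarrow> nat" where
  "l_idx m d j = nat (if real j \<le> real m / 2
     then int j - \<lceil>real d / 2\<rceil> + 1
     else max 0 (int m - int j - \<lceil>real d / 2\<rceil> + 1))"

definition N_bound :: "nat \<Rightarrow> real \<Rightarrow> int" where
  "N_bound s \<beta> = \<lceil>2 powr (real s + \<beta>)\<rceil>"

definition w_star :: "nat \<Rightarrow> nat \<Rightarrow> real \<Rightarrow> nat \<Rightarrow> nat" where
  "w_star s m \<beta> d =
     (let W = {w. d \<le> w \<and> w \<le> m \<and> int (\<Sum>j=d..w. m choose l_idx m d j) \<ge> N_bound s \<beta> - 1}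
      in if W = {} then 0 else Min W)"

definition N_star :: "nat \<Rightarrow> nat \<Rightarrow> real \<Rightarrow> nat \<Rightarrow> nat" where
  "N_star s m \<beta> d = (\<Sum>j=d..<w_star s m \<beta> d. m choose l_idx m d j)"

definition B :: "nat \<Rightarrow> nat \<Rightarrow> real \<Rightarrow> nat \<Rightarrow> real \<Rightarrow> real" where
  "B s m \<beta> d lam =
     (let \<rho> = 1 - 2 * lam; w = w_star s m \<beta> d in
      2 powr (- \<beta>) + 2 powr (- real s - \<beta>) *
        ((\<Sum>j=d..<w. real (m choose l_idx m d j) * (1 + \<rho> ^ j) ^ s)
         + (of_int (N_bound s \<beta>) - 1 - real (N_star s m \<beta> d)) * (1 + \<rho> ^ w) ^ s) - 1)"

end

theory Submission
  imports Defs
begin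

text \<open>
  The indicator of an XOR constraint at an assignment is the mean of \<open>1\<close> and a Walsh character of
  the random coefficients, so two assignments at Hamming distance \<open>j\<close> satisfy a random constraint
  simultaneously with probability \<open>(1 + \<rho> ^ j) / 4\<close>. Hence \<open>var T / \<mu>\<^sup>2 + 1\<close> is
  the average of \<open>(1 + \<rho> ^ dist u v) ^ s\<close> over all pairs of models, the diagonal included.
  For fixed \<open>u\<close>, the models at distance \<open>j\<close> from \<open>u\<close> form a constant weight code, and any two
  members sharing an \<open>l\<^sub>j\<close>-subset of their supports (of the complements of their supports if
  \<open>j > m / 2\<close>) coincide; so there are at most \<open>m choose l\<^sub>j\<close> of them. As the summand decreases in
  \<open>j\<close>, filling the distance classes greedily bounds the sum, and since the average of an initial
  segment of a decreasing sequence decreases with its length, the number of models may be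
  replaced by \<open>N\<close>.
\<close>

subsection \<open>Constant weight codes\<close>

lemma card_packing_le_choose:
  fixes F :: "'a set set"
  assumes "finite X" and sub: "\<And>A. A \<in> F \<Longrightarrow> A \<subseteq> X" and large: "\<And>A. A \<in> F \<Longrightarrow> t \<le> card A"
    and packing: "pairwise (\<lambda>A B. card (A \<inter> B) < t) F"
  shows "card F \<le> card X choose t"
proof -
  have "\<exists>K\<subseteq>A. card K = t" if "A \<in> F" for A
    using obtain_subset_with_card_n[OF large[OF that]] by blast
  then obtain g where g: "\<And>A. A \<in> F \<Longrightarrow> g A \<subseteq> A \<and> card (g A) = t"
    by metis
  have "inj_on g F"
  proof (rule inj_onI, rule ccontr)
    fix A B assume members: "A \<in> F" "B \<in> F" "g A = g B" "A \<noteq> B"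
    have "g A \<subseteq> A \<inter> B"
      using g[OF members(1)] g[OF members(2)] members(3) by auto
    moreover have "finite (A \<inter> B)"
      using sub[OF members(1)] \<open>finite X\<close> by (auto intro: finite_subset)
    ultimately have "t \<le> card (A \<inter> B)"
      using g[OF members(1)] card_mono by metis
    then show False
      using pairwiseD[OF packing members(1,2,4)] by simp
  qed
  moreover have "g ` F \<subseteq> {K. K \<subseteq> X \<and> card K = t}"
    using g sub by blast
  ultimately show ?thesis
    using card_inj_on_le[of g F "{K. K \<subseteq> X \<and> card K = t}"] \<open>finite X\<close> by (simp add: n_subsets)
qed

lemma card_constant_weight_code_le:
  fixes F :: "'a set set"
  assumes "finite X" and sub: "\<And>A. A \<in> F \<Longrightarrow> A \<subseteq> X" and weight: "\<And>A. A \<in> F \<Longrightarrow> card A = j"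
    and "d \<ge> 1" and code: "pairwise (\<lambda>A B. d \<le> card (sym_diff A B)) F"
  shows "card F \<le> card X choose (j + 1 - (d + 1) div 2)"
proof (rule card_packing_le_choose[OF \<open>finite X\<close> sub])
  show "j + 1 - (d + 1) div 2 \<le> card A" if "A \<in> F" for A
    using weight[OF that] \<open>d \<ge> 1\<close> by simp
  show "pairwise (\<lambda>A B. card (A \<inter> B) < j + 1 - (d + 1) div 2) F"
  proof (rule pairwiseI)
    fix A B assume members: "A \<in> F" "B \<in> F" "A \<noteq> B"
    have fin: "finite A" "finite B"
      using sub members(1,2) \<open>finite X\<close> by (blast intro: finite_subset)+
    have "card (sym_diff A B) = card (A - B) + card (B - A)"
      using fin by (intro card_Un_disjoint) auto
    moreover have "card (A \<inter> B) + card (A - B) = j" "card (A \<inter> B) + card (B - A) = j"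
      using card_Int_Diff[OF fin(1), of B] card_Int_Diff[OF fin(2), of A] weight members
      by (simp_all add: Int_commute)
    ultimately show "card (A \<inter> B) < j + 1 - (d + 1) div 2"
      using pairwiseD[OF code members] by simp
  qed
qed

lemma card_constant_weight_code_le_complement:
  fixes F :: "'a set set"
  assumes "finite X" and sub: "\<And>A. A \<in> F \<Longrightarrow> A \<subseteq> X" and weight: "\<And>A. A \<in> F \<Longrightarrow> card A = j"
    and "d \<ge> 1" and code: "pairwise (\<lambda>A B. d \<le> card (sym_diff A B)) F"
  shows "card F \<le> card X choose (card X - j + 1 - (d + 1) div 2)"
proof -
  have "inj_on (\<lambda>A. X - A) F"
    using sub by (intro inj_onI) blast
  moreover have "card ((\<lambda>A. X - A) ` F) \<le> card X choose (card X - j + 1 - (d + 1) div 2)"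
  proof (rule card_constant_weight_code_le[OF \<open>finite X\<close> _ _ \<open>d \<ge> 1\<close>])
    have "card (X - A) = card X - j" if "A \<in> F" for A
      using card_Diff_subset[OF finite_subset[OF sub[OF that] \<open>finite X\<close>] sub[OF that]]
        weight[OF that] by simp
    then show "card A = card X - j" if "A \<in> (\<lambda>A. X - A) ` F" for A
      using that by blast
    show "pairwise (\<lambda>A B. d \<le> card (sym_diff A B)) ((\<lambda>A. X - A) ` F)"
    proof (rule pairwise_imageI)
      fix A B assume "A \<in> F" "B \<in> F" "A \<noteq> B"
      moreover from this have "sym_diff (X - A) (X - B) = sym_diff A B"
        using sub[of A] sub[of B] by auto
      ultimately show "d \<le> card (sym_diff (X - A) (X - B))"
        using pairwiseD[OF code] by simp
    qed
  qed auto
  ultimately show ?thesis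
    by (simp add: card_image)
qed

subsection \<open>Distance classes\<close>

definition disagreement :: "nat \<Rightarrow> (nat \<Rightarrow> bool) \<Rightarrow> (nat \<Rightarrow> bool) \<Rightarrow> nat set" where
  "disagreement m u v = {i \<in> {1..m}. u i \<noteq> v i}"

lemma hamming_dist_eq_card_disagreement: "hamming_dist m u v = card (disagreement m u v)"
  by (simp add: hamming_dist_def disagreement_def)

lemma sym_diff_disagreement:
  "sym_diff (disagreement m u v) (disagreement m u w) = disagreement m v w"
  by (auto simp: disagreement_def)

lemma hamming_dist_self [simp]: "hamming_dist m u u = 0"
  by (simp add: hamming_dist_def)

lemma hamming_dist_le: "hamming_dist m u v \<le> m"
  unfolding hamming_dist_def by (rule order_trans[OF card_mono[of "{1..m}"]]) auto

lemma ceiling_half_nat: "\<lceil>real d / 2\<rceil> = int ((d + 1) div 2)"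
  by (cases "even d") (auto elim!: evenE oddE intro!: ceiling_unique)

lemma l_idx_eq:
  assumes "j \<le> m"
  shows "l_idx m d j = (if real j \<le> real m / 2 then j else m - j) + 1 - (d + 1) div 2"
  using assms unfolding l_idx_def ceiling_half_nat by (auto simp: nat_diff_distrib')

definition num_at_dist :: "nat \<Rightarrow> (nat \<Rightarrow> bool) set \<Rightarrow> (nat \<Rightarrow> bool) \<Rightarrow> nat \<Rightarrow> nat" where
  "num_at_dist m M u j = card {v \<in> M. hamming_dist m u v = j}"

lemma num_at_dist_le_choose:
  assumes "d \<ge> 1" and "j \<le> m" and code: "pairwise (\<lambda>v w. d \<le> hamming_dist m v w) M"
  shows "num_at_dist m M u j \<le> m choose l_idx m d j"
proof -
  define S where "S = {v \<in> M. hamming_dist m u v = j}"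
  define F where "F = disagreement m u ` S"
  have dist: "d \<le> card (sym_diff (disagreement m u v) (disagreement m u w))"
    if "v \<in> S" "w \<in> S" "v \<noteq> w" for v w
    using pairwiseD[OF code, of v w] that
    by (simp add: S_def sym_diff_disagreement hamming_dist_eq_card_disagreement)
  then have "inj_on (disagreement m u) S"
    using \<open>d \<ge> 1\<close> by (fastforce intro: inj_onI)
  then have "num_at_dist m M u j = card F"
    by (simp add: num_at_dist_def F_def S_def card_image)
  moreover have F_weight: "A \<subseteq> {1..m}" "card A = j" if "A \<in> F" for A
    using that by (auto simp: F_def S_def disagreement_def hamming_dist_def)
  moreover have F_code: "pairwise (\<lambda>A B. d \<le> card (sym_diff A B)) F"
    unfolding F_def using dist by (intro pairwise_imageI) blast
  ultimately show ?thesis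
    using card_constant_weight_code_le[OF finite_atLeastAtMost F_weight \<open>d \<ge> 1\<close> F_code]
      card_constant_weight_code_le_complement[OF finite_atLeastAtMost F_weight \<open>d \<ge> 1\<close> F_code]
    by (simp add: l_idx_eq[OF \<open>j \<le> m\<close>])
qed

lemma sum_hamming_dist_eq:
  fixes f :: "nat \<Rightarrow> real"
  assumes "finite M" and "u \<in> M" and "d \<ge> 1"
    and code: "pairwise (\<lambda>v w. d \<le> hamming_dist m v w) M"
  shows "(\<Sum>v\<in>M. f (hamming_dist m u v)) = f 0 + (\<Sum>j=d..m. real (num_at_dist m M u j) * f j)"
proof -
  have range: "hamming_dist m u ` (M - {u}) \<subseteq> {d..m}"
    using pairwiseD[OF code \<open>u \<in> M\<close>] hamming_dist_le by fastforce
  have "{v \<in> M - {u}. hamming_dist m u v = j} = {v \<in> M. hamming_dist m u v = j}"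
    if "j \<in> {d..m}" for j
    using that \<open>d \<ge> 1\<close> by auto
  then have "(\<Sum>j=d..m. real (num_at_dist m M u j) * f j) =
      (\<Sum>j=d..m. \<Sum>v\<in>{v \<in> M - {u}. hamming_dist m u v = j}. f (hamming_dist m u v))"
    by (intro sum.cong refl) (simp add: num_at_dist_def del: Diff_iff)
  also have "\<dots> = (\<Sum>v\<in>M - {u}. f (hamming_dist m u v))"
    using \<open>finite M\<close> range by (intro sum.group) auto
  finally show ?thesis
    using sum.remove[OF assms(1,2), of "\<lambda>v. f (hamming_dist m u v)"] by simp
qed

subsection \<open>Greedy filling of the distance classes\<close>

definition greedy_sum :: "('a \<Rightarrow> real) \<Rightarrow> ('a \<Rightarrow> real) \<Rightarrow> 'a set \<Rightarrow> 'a \<Rightarrow> real \<Rightarrow> real" where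
  "greedy_sum b f K w r = (\<Sum>j\<in>K. b j * f j) + (r - (\<Sum>j\<in>K. b j)) * f w"

lemma greedy_sum_eq: "greedy_sum b f K w r = (\<Sum>j\<in>K. b j * (f j - f w)) + r * f w"
  by (simp add: greedy_sum_def algebra_simps sum_subtractf sum_distrib_left)

text \<open>The threshold \<open>w\<close> is arbitrary, although the weight left over for it may then be negative: by
  duality every choice gives a valid bound, and \<open>w\<^sup>*\<close> is merely the best one.\<close>

lemma sum_le_greedy_sum:
  fixes f :: "'a::linorder \<Rightarrow> real"
  assumes "finite J" and "\<And>j. j \<in> J \<Longrightarrow> 0 \<le> c j" and "\<And>j. j \<in> J \<Longrightarrow> c j \<le> b j" and "antimono f"
  shows "(\<Sum>j\<in>J. c j * f j) \<le> greedy_sum b f {j \<in> J. j < w} w (\<Sum>j\<in>J. c j)"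
proof -
  have "(\<Sum>j\<in>J. c j * (f j - f w)) \<le> (\<Sum>j\<in>J. if j < w then b j * (f j - f w) else 0)"
  proof (rule sum_mono)
    fix j assume "j \<in> J"
    then show "c j * (f j - f w) \<le> (if j < w then b j * (f j - f w) else 0)"
      using assms antimonoD[OF \<open>antimono f\<close>, of j w] antimonoD[OF \<open>antimono f\<close>, of w j]
      by (auto intro!: mult_right_mono mult_nonneg_nonpos)
  qed
  also have "\<dots> = (\<Sum>j\<in>{j \<in> J. j < w}. b j * (f j - f w))"
    using \<open>finite J\<close> by (rule sum.inter_filter[symmetric])
  finally show ?thesis
    by (simp add: greedy_sum_eq right_diff_distrib[of "c _"] sum_subtractf sum_distrib_right)
qed

lemma greedy_average_decreasing:
  assumes "f w \<le> a" and "\<And>j. j \<in> K \<Longrightarrow> 0 \<le> b j" and "\<And>j. j \<in> K \<Longrightarrow> f w \<le> f j"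
    and "0 < N" and "N \<le> n"
  shows "(a + greedy_sum b f K w (n - 1)) / n \<le> (a + greedy_sum b f K w (N - 1)) / N"
proof -
  define G where "G = a - f w + (\<Sum>j\<in>K. b j * (f j - f w))"
  have average_eq: "(a + greedy_sum b f K w (x - 1)) / x = f w + G / x" if "x > 0" for x
    using that by (simp add: greedy_sum_eq G_def field_simps)
  have "G \<ge> 0"
    unfolding G_def using assms by (intro add_nonneg_nonneg sum_nonneg mult_nonneg_nonneg) auto
  then have "G / n \<le> G / N"
    using assms by (intro divide_left_mono) auto
  then show ?thesis
    using assms by (simp add: average_eq)
qed

lemma average_over_pairs_le_greedy:
  fixes f :: "nat \<Rightarrow> real"
  assumes "finite M" and "d \<ge> 1" and code: "pairwise (\<lambda>u v. d \<le> hamming_dist m u v) M"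
    and "w \<le> m" and "0 < N" and "N \<le> real (card M)" and "antimono f"
  shows "(\<Sum>u\<in>M. \<Sum>v\<in>M. f (hamming_dist m u v)) / (real (card M))\<^sup>2 \<le>
    (f 0 + greedy_sum (\<lambda>j. real (m choose l_idx m d j)) f {d..<w} w (N - 1)) / N"
    (is "_ \<le> (f 0 + ?G (N - 1)) / N")
proof -
  define n where "n = real (card M)"
  have "n > 0"
    using assms by (simp add: n_def)
  have row: "(\<Sum>v\<in>M. f (hamming_dist m u v)) \<le> f 0 + ?G (n - 1)" if "u \<in> M" for u
  proof -
    note sum_over_classes = sum_hamming_dist_eq[OF \<open>finite M\<close> that \<open>d \<ge> 1\<close> code]
    have below: "{j \<in> {d..m}. j < w} = {d..<w}"
      using \<open>w \<le> m\<close> by auto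
    have "(\<Sum>j=d..m. real (num_at_dist m M u j) * f j) \<le> ?G (\<Sum>j=d..m. real (num_at_dist m M u j))"
      unfolding below[symmetric] using assms
      by (intro sum_le_greedy_sum) (auto simp: num_at_dist_le_choose)
    moreover have "(\<Sum>j=d..m. real (num_at_dist m M u j)) = n - 1"
      using sum_over_classes[of "\<lambda>_. 1"] by (simp add: n_def)
    ultimately show ?thesis
      using sum_over_classes[of f] by simp
  qed
  have "(\<Sum>u\<in>M. \<Sum>v\<in>M. f (hamming_dist m u v)) \<le> n * (f 0 + ?G (n - 1))"
    using sum_bounded_above[OF row] by (simp add: n_def)
  then have "(\<Sum>u\<in>M. \<Sum>v\<in>M. f (hamming_dist m u v)) / n\<^sup>2 \<le> (f 0 + ?G (n - 1)) / n"
    using \<open>n > 0\<close> by (simp add: field_simps power2_eq_square)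
  also have "\<dots> \<le> (f 0 + ?G (N - 1)) / N"
    using assms by (intro greedy_average_decreasing) (auto simp: n_def intro: antimonoD)
  finally show ?thesis
    by (simp add: n_def)
qed

subsection \<open>Walsh characters\<close>

definition bool_sign :: "bool \<Rightarrow> real" where
  "bool_sign b = (if b then - 1 else 1)"

definition walsh :: "'a set \<Rightarrow> ('a \<Rightarrow> bool) \<Rightarrow> real" where
  "walsh S a = (\<Prod>i\<in>S. bool_sign (a i))"

lemma walsh_mult:
  assumes "finite S" "finite T"
  shows "walsh S a * walsh T a = walsh (sym_diff S T) a"
proof -
  have "walsh S a = walsh (S \<inter> T) a * walsh (S - T) a"
    "walsh T a = walsh (S \<inter> T) a * walsh (T - S) a"
    unfolding walsh_def using assms prod.Int_Diff[of S _ T] prod.Int_Diff[of T _ S]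
    by (simp_all add: Int_commute)
  moreover have "walsh (S \<inter> T) a * walsh (S \<inter> T) a = 1"
    unfolding walsh_def prod.distrib[symmetric] by (rule prod.neutral) (simp add: bool_sign_def)
  moreover have "walsh (sym_diff S T) a = walsh (S - T) a * walsh (T - S) a"
    unfolding walsh_def using assms by (intro prod.union_disjoint) auto
  ultimately show ?thesis
    by algebra
qed

text \<open>The library's \<open>expectation_prod_Pi_pmf\<close> is restricted to nonnegative factors.\<close>

lemma expectation_prod_Pi_pmf_subset:
  fixes f :: "'a \<Rightarrow> 'b \<Rightarrow> 'c::{real_normed_field, banach, second_countable_topology}"
  assumes "finite A" and "S \<subseteq> A" and int: "\<And>x. x \<in> S \<Longrightarrow> integrable (measure_pmf (p x)) (f x)"
  shows "measure_pmf.expectation (Pi_pmf A dflt p) (\<lambda>y. \<Prod>x\<in>S. f x (y x)) =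
    (\<Prod>x\<in>S. measure_pmf.expectation (p x) (f x))"
proof -
  have component: "map_pmf (\<lambda>y. y x) (Pi_pmf A dflt p) = p x" if "x \<in> S" for x
    using that assms(1,2) by (auto simp: Pi_pmf_component)
  have "prob_space.indep_vars (measure_pmf (Pi_pmf A dflt p)) (\<lambda>_. borel) (\<lambda>x y. f x (y x)) A"
    by (intro prob_space.indep_vars_compose2[OF _ indep_vars_Pi_pmf])
       (auto simp: measure_pmf.prob_space_axioms \<open>finite A\<close>)
  then have "measure_pmf.expectation (Pi_pmf A dflt p) (\<lambda>y. \<Prod>x\<in>S. f x (y x)) =
      (\<Prod>x\<in>S. measure_pmf.expectation (Pi_pmf A dflt p) (\<lambda>y. f x (y x)))"
  proof (intro prob_space.indep_vars_lebesgue_integral)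
    show "integrable (measure_pmf (Pi_pmf A dflt p)) (\<lambda>y. f x (y x))" if "x \<in> S" for x
      using int[OF that] by (simp flip: component[OF that])
  qed (use assms(1,2) in \<open>auto intro: prob_space.indep_vars_subset finite_subset measure_pmf.prob_space_axioms\<close>)
  also have "\<dots> = (\<Prod>x\<in>S. measure_pmf.expectation (p x) (f x))"
    by (intro prod.cong refl) (simp flip: component)
  finally show ?thesis .
qed

lemma expectation_bernoulli_bool_sign:
  assumes "0 \<le> p" "p \<le> 1"
  shows "measure_pmf.expectation (bernoulli_pmf p) bool_sign = 1 - 2 * p"
  using assms by (simp add: bool_sign_def)

lemma expectation_walsh_xor_coeffs:
  assumes "0 \<le> lam" "lam \<le> 1" and "S \<subseteq> {0..m}"
  shows "measure_pmf.expectation (xor_coeffs_pmf m lam) (walsh S) =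
    (if 0 \<in> S then 0 else (1 - 2 * lam) ^ card S)"
proof -
  have "measure_pmf.expectation (xor_coeffs_pmf m lam) (walsh S) =
      (\<Prod>i\<in>S. measure_pmf.expectation
        (if i = 0 then bernoulli_pmf (1 / 2) else bernoulli_pmf lam) bool_sign)"
    unfolding xor_coeffs_pmf_def walsh_def using assms(3)
    by (intro expectation_prod_Pi_pmf_subset) (auto intro: integrable_measure_pmf_finite)
  also have "\<dots> = (\<Prod>i\<in>S. if i = 0 then 0 else 1 - 2 * lam)"
    using assms(1,2) by (intro prod.cong refl) (simp add: expectation_bernoulli_bool_sign del: integral_bernoulli_pmf)
  also have "\<dots> = (if 0 \<in> S then 0 else (1 - 2 * lam) ^ card S)"
    using finite_subset[OF assms(3)] by (auto simp flip: prod_constant intro!: prod.cong)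
  finally show ?thesis .
qed

subsection \<open>Random XOR constraints\<close>

text \<open>The index \<open>0\<close> stands for the constant coefficient \<open>a 0\<close>, which enters the parity of every
  assignment.\<close>

definition xor_support :: "nat \<Rightarrow> (nat \<Rightarrow> bool) \<Rightarrow> nat set" where
  "xor_support m v = insert 0 {i \<in> {1..m}. v i}"

lemma sym_diff_xor_support: "sym_diff (xor_support m u) (xor_support m v) = disagreement m u v"
  by (auto simp: xor_support_def disagreement_def)

lemma bool_sign_holds_foldr_Xor:
  "bool_sign (holds v (foldr Xor ps (Const False))) = (\<Prod>p\<leftarrow>ps. bool_sign (holds v p))"
  by (induction ps) (auto simp: bool_sign_def)

lemma of_bool_holds_xor_constraint:
  "of_bool (holds v (xor_constraint m a)) = (1 + walsh (xor_support m v) a) / 2"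
proof -
  define parity where
    "parity = foldr Xor (map (\<lambda>i. Conj (Const (a i)) (Var i)) [1..<Suc m]) (Const False)"
  have "bool_sign (holds v parity) = (\<Prod>i\<in>{1..m}. bool_sign (a i \<and> v i))"
    unfolding parity_def bool_sign_holds_foldr_Xor
    by (simp add: o_def prod.distinct_set_conv_list[symmetric] atLeastLessThanSuc_atLeastAtMost
        del: upt_Suc)
  also have "\<dots> = (\<Prod>i\<in>{i \<in> {1..m}. v i}. bool_sign (a i))"
    by (subst prod.inter_filter) (auto simp: bool_sign_def intro!: prod.cong)
  finally have "walsh (xor_support m v) a = bool_sign (a 0) * bool_sign (holds v parity)"
    by (simp add: walsh_def xor_support_def)
  then show ?thesis
    unfolding xor_constraint_def parity_def[symmetric] by (simp add: bool_sign_def)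
qed

definition xor_constraint_pmf :: "nat \<Rightarrow> real \<Rightarrow> nat formula pmf" where
  "xor_constraint_pmf m lam = map_pmf (xor_constraint m) (xor_coeffs_pmf m lam)"

lemma finite_set_xor_coeffs_pmf: "finite (set_pmf (xor_coeffs_pmf m lam))"
  unfolding xor_coeffs_pmf_def by (subst set_Pi_pmf) auto

lemma prob_holds_both_xor_constraint:
  assumes "0 \<le> lam" "lam \<le> 1"
  shows "measure_pmf.prob (xor_constraint_pmf m lam) {q. holds u q \<and> holds v q} =
    (1 + (1 - 2 * lam) ^ hamming_dist m u v) / 4"
proof -
  let ?E = "measure_pmf.expectation (xor_coeffs_pmf m lam)"
  define parity_sign where "parity_sign w = walsh (xor_support m w)" for w
  have supports: "xor_support m w \<subseteq> {0..m}" "disagreement m u v \<subseteq> {0..m}" "0 \<notin> disagreement m u v"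
    for w
    by (auto simp: xor_support_def disagreement_def)
  have "parity_sign u a * parity_sign v a = walsh (disagreement m u v) a" for a
    unfolding parity_sign_def sym_diff_xor_support[symmetric]
    by (rule walsh_mult) (simp_all add: xor_support_def)
  then have indicator_eq: "indicat_real
      {a. holds u (xor_constraint m a) \<and> holds v (xor_constraint m a)} a =
      (1 + parity_sign u a + parity_sign v a + walsh (disagreement m u v) a) / 4" for a
    unfolding indicator_def mem_Collect_eq of_bool_conj of_bool_holds_xor_constraint parity_sign_def[symmetric]
    by (simp add: field_simps)
  have "measure_pmf.prob (xor_constraint_pmf m lam) {q. holds u q \<and> holds v q} =
      ?E (indicat_real {a. holds u (xor_constraint m a) \<and> holds v (xor_constraint m a)})"
    by (simp add: xor_constraint_pmf_def vimage_def)
  also have "\<dots> = (1 + ?E (parity_sign u) + ?E (parity_sign v) + ?E (walsh (disagreement m u v))) / 4"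
    unfolding indicator_eq
    by (simp add: integrable_measure_pmf_finite finite_set_xor_coeffs_pmf)
  also have "\<dots> = (1 + (1 - 2 * lam) ^ hamming_dist m u v) / 4"
    unfolding parity_sign_def hamming_dist_eq_card_disagreement
    using supports by (simp add: expectation_walsh_xor_coeffs[OF assms] xor_support_def)
  finally show ?thesis .
qed

lemma prob_holds_xor_constraint:
  assumes "0 \<le> lam" "lam \<le> 1"
  shows "measure_pmf.prob (xor_constraint_pmf m lam) {q. holds v q} = 1 / 2"
  using prob_holds_both_xor_constraint[OF assms, of m v v] by simp

subsection \<open>Moments of the number of models\<close>

lemma expectation_card_filter:
  assumes "finite M"
  shows "measure_pmf.expectation p (\<lambda>c. real (card {v \<in> M. P v c})) =
    (\<Sum>v\<in>M. measure_pmf.prob p {c. P v c})"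
proof -
  have "real (card {v \<in> M. P v c}) = (\<Sum>v\<in>M. indicat_real {c. P v c} c)" for c
    using assms by (simp add: indicator_def sum.If_cases Int_def)
  then have "measure_pmf.expectation p (\<lambda>c. real (card {v \<in> M. P v c})) =
      (\<Sum>v\<in>M. measure_pmf.expectation p (indicat_real {c. P v c}))"
    by (subst Bochner_Integration.integral_sum[symmetric])
       (auto simp: less_top[symmetric])
  then show ?thesis
    by simp
qed

lemma expectation_card_filter_square:
  assumes "finite M"
  shows "measure_pmf.expectation p (\<lambda>c. (real (card {v \<in> M. P v c}))\<^sup>2) =
    (\<Sum>u\<in>M. \<Sum>v\<in>M. measure_pmf.prob p {c. P u c \<and> P v c})"
proof -
  have "{x \<in> M \<times> M. P (fst x) c \<and> P (snd x) c} = {v \<in> M. P v c} \<times> {v \<in> M. P v c}" for c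
    by auto
  then have square_eq: "(real (card {v \<in> M. P v c}))\<^sup>2 =
      real (card {x \<in> M \<times> M. P (fst x) c \<and> P (snd x) c})" for c
    by (simp add: card_cartesian_product power2_eq_square)
  show ?thesis
    unfolding square_eq
    using assms by (simp add: expectation_card_filter sum.cartesian_product case_prod_beta)
qed

lemma prob_Pi_pmf_all:
  assumes "finite A"
  shows "measure_pmf.prob (Pi_pmf A dflt (\<lambda>_. q)) {c. \<forall>i\<in>A. Q (c i)} =
    measure_pmf.prob q {x. Q x} ^ card A"
proof -
  have "{c. \<forall>i\<in>A. Q (c i)} = Pi A (\<lambda>_. {x. Q x})"
    by auto
  then show ?thesis
    using measure_Pi_pmf_Pi[of A dflt "\<lambda>_. q" "\<lambda>_. {x. Q x}"] assms by simp
qed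

lemma finite_models: "finite (models m p)"
  unfolding models_def by (rule finite_subset[of _ "{1..m} \<rightarrow>\<^sub>E UNIV"]) (auto intro: finite_PiE)

lemma holds_foldl_Conj: "holds v (foldl Conj p ps) \<longleftrightarrow> holds v p \<and> (\<forall>q\<in>set ps. holds v q)"
  by (induction ps arbitrary: p) auto

lemma num_models_conj_constraints:
  "num_models m (conj_constraints s p c) = card {v \<in> models m p. \<forall>i\<in>{1..s}. holds v (c i)}"
  unfolding num_models_def
  by (rule arg_cong[of _ _ card]) (auto simp: models_def conj_constraints_def holds_foldl_Conj)

lemma expectation_num_models:
  assumes "0 \<le> lam" "lam \<le> 1"
  shows "measure_pmf.expectation (constraints_pmf s m lam)
      (\<lambda>c. real (num_models m (conj_constraints s p c))) = real (num_models m p) / 2 ^ s"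
  unfolding num_models_conj_constraints expectation_card_filter[OF finite_models]
    constraints_pmf_def xor_constraint_pmf_def[symmetric]
  by (simp add: prob_Pi_pmf_all prob_holds_xor_constraint[OF assms] num_models_def power_one_over)

lemma expectation_num_models_square:
  assumes "0 \<le> lam" "lam \<le> 1"
  shows "measure_pmf.expectation (constraints_pmf s m lam)
      (\<lambda>c. (real (num_models m (conj_constraints s p c)))\<^sup>2) =
      (\<Sum>u\<in>models m p. \<Sum>v\<in>models m p. (1 + (1 - 2 * lam) ^ hamming_dist m u v) ^ s) / 4 ^ s"
  unfolding num_models_conj_constraints expectation_card_filter_square[OF finite_models]
    constraints_pmf_def xor_constraint_pmf_def[symmetric] ball_conj_distrib[symmetric]
  by (simp add: prob_Pi_pmf_all[where Q = "\<lambda>q. holds _ q \<and> holds _ q"]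
      prob_holds_both_xor_constraint[OF assms] power_divide sum_divide_distrib)

lemma relative_variance_num_models:
  fixes s m :: nat and p :: "nat formula" and lam :: real
  assumes "0 \<le> lam" "lam \<le> 1" and "num_models m p > 0"
  defines "T \<equiv> \<lambda>c. real (num_models m (conj_constraints s p c))"
  shows "measure_pmf.variance (constraints_pmf s m lam) T
      / (measure_pmf.expectation (constraints_pmf s m lam) T)\<^sup>2 =
      (\<Sum>u\<in>models m p. \<Sum>v\<in>models m p. (1 + (1 - 2 * lam) ^ hamming_dist m u v) ^ s)
      / (real (num_models m p))\<^sup>2 - 1"
proof -
  have "finite (set_pmf (constraints_pmf s m lam))"
    unfolding constraints_pmf_def
    by (subst set_Pi_pmf) (auto simp: finite_set_xor_coeffs_pmf)
  then have "measure_pmf.variance (constraints_pmf s m lam) T =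
      measure_pmf.expectation (constraints_pmf s m lam) (\<lambda>c. (T c)\<^sup>2)
      - (measure_pmf.expectation (constraints_pmf s m lam) T)\<^sup>2"
    by (intro measure_pmf.variance_eq integrable_measure_pmf_finite)
  moreover have "(2 ^ s :: real)\<^sup>2 = 4 ^ s"
    by (simp add: power2_eq_square flip: power_mult_distrib)
  ultimately show ?thesis
    using assms(3) unfolding T_def expectation_num_models[OF assms(1,2)]
      expectation_num_models_square[OF assms(1,2)]
    by (simp add: power_divide diff_divide_distrib left_diff_distrib)
qed

subsection \<open>The variance bound\<close>

lemma w_star_le: "w_star s m \<beta> d \<le> m"
proof -
  define W where "W = {w. d \<le> w \<and> w \<le> m \<and> int (\<Sum>j=d..w. m choose l_idx m d j) \<ge> N_bound s \<beta> - 1}"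
  have "finite W"
    unfolding W_def by (rule finite_subset[of _ "{..m}"]) auto
  then have "Min W \<le> m" if "W \<noteq> {}"
    using Min_in[OF _ that] by (simp add: W_def)
  then show ?thesis
    by (simp add: w_star_def Let_def W_def)
qed

lemma B_eq_greedy_sum:
  fixes lam :: real and s :: nat
  defines "f \<equiv> \<lambda>j. (1 + (1 - 2 * lam) ^ j) ^ s"
  shows "B s m \<beta> d lam = (f 0 + greedy_sum (\<lambda>j. real (m choose l_idx m d j)) f
      {d..<w_star s m \<beta> d} (w_star s m \<beta> d) (of_int (N_bound s \<beta>) - 1)) / 2 powr (real s + \<beta>) - 1"
proof -
  have powr_eq: "2 powr (- \<beta>) = (2 ^ s) / 2 powr (real s + \<beta>)"
    "2 powr (- real s - \<beta>) = 1 / 2 powr (real s + \<beta>)"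
    by (simp_all add: powr_minus_divide powr_diff powr_add powr_realpow)
  show ?thesis
    unfolding B_def Let_def N_star_def greedy_sum_def f_def powr_eq
    by (simp add: add_divide_distrib)
qed

lemma powr_le_N_bound: "2 powr (real s + \<beta>) \<le> of_int (N_bound s \<beta>)"
  unfolding N_bound_def by (rule le_of_int_ceiling)

lemma N_bound_le_of_nat:
  assumes "2 powr (real s + \<beta>) \<le> real n"
  shows "of_int (N_bound s \<beta>) \<le> real n"
proof -
  have "N_bound s \<beta> \<le> int n"
    using assms by (simp add: N_bound_def ceiling_le_iff)
  then show ?thesis
    by (metis of_int_le_iff of_int_of_nat_eq)
qed

lemma average_over_pairs_le_B:
  fixes lam :: real
  assumes "finite M" and "d \<ge> 1" and code: "pairwise (\<lambda>u v. d \<le> hamming_dist m u v) M"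
    and "0 \<le> lam" and "lam \<le> 1 / 2" and size: "2 powr (real s + \<beta>) \<le> real (card M)"
  shows "(\<Sum>u\<in>M. \<Sum>v\<in>M. (1 + (1 - 2 * lam) ^ hamming_dist m u v) ^ s) / (real (card M))\<^sup>2 - 1
    \<le> B s m \<beta> d lam"
proof -
  define f where "f j = (1 + (1 - 2 * lam) ^ j) ^ s" for j
  define N where "N = real_of_int (N_bound s \<beta>)"
  define R where "R = f 0 + greedy_sum (\<lambda>j. real (m choose l_idx m d j)) f
      {d..<w_star s m \<beta> d} (w_star s m \<beta> d) (N - 1)"
  define avg where "avg = (\<Sum>u\<in>M. \<Sum>v\<in>M. f (hamming_dist m u v)) / (real (card M))\<^sup>2"
  have "antimono f" and f_nonneg: "0 \<le> f j" for j
    unfolding f_def using assms(4,5)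
    by (auto intro!: antimonoI power_mono add_left_mono power_decreasing)
  have "0 < 2 powr (real s + \<beta>)"
    by simp
  moreover have "2 powr (real s + \<beta>) \<le> N"
    unfolding N_def by (rule powr_le_N_bound)
  ultimately have N_bounds: "0 < N" "0 < 2 powr (real s + \<beta>)" "2 powr (real s + \<beta>) \<le> N"
    by linarith+
  have "N \<le> real (card M)"
    unfolding N_def using size by (rule N_bound_le_of_nat)
  then have avg_le: "avg \<le> R / N"
    unfolding avg_def R_def
    by (intro average_over_pairs_le_greedy assms(1-3) w_star_le N_bounds(1) \<open>antimono f\<close>)
  moreover have "0 \<le> avg"
    unfolding avg_def by (intro divide_nonneg_nonneg sum_nonneg f_nonneg) simp
  ultimately have "0 \<le> R / N"
    by linarith
  then have "0 \<le> R"
    using N_bounds(1) by (simp add: zero_le_divide_iff)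
  then have "R / N \<le> R / 2 powr (real s + \<beta>)"
    by (rule divide_left_mono[OF N_bounds(3) _ mult_pos_pos[OF N_bounds(1,2)]])
  moreover have "R / 2 powr (real s + \<beta>) - 1 = B s m \<beta> d lam"
    unfolding B_eq_greedy_sum R_def N_def f_def ..
  ultimately show ?thesis
    using avg_le unfolding avg_def f_def by linarith
qed

theorem theorem2:
  fixes m d s :: nat and \<phi> :: "nat formula" and \<beta> lam :: real and T :: "(nat \<Rightarrow> nat formula) \<Rightarrow> real"
  assumes "vars \<phi> \<subseteq> {1..m}"
    and "d \<ge> 1"
    and "\<And>u v. u \<in> models m \<phi> \<Longrightarrow> v \<in> models m \<phi> \<Longrightarrow> u \<noteq> v \<Longrightarrow> hamming_dist m u v \<ge> d"
    and "s \<ge> 1"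
    and "\<beta> > 0"
    and "0 < lam" and "lam \<le> 1 / 2"
    and "real (num_models m \<phi>) > 2 powr (real s + \<beta>)"
    and "T = (\<lambda>c. real (num_models m (conj_constraints s \<phi> c)))"
  shows "measure_pmf.variance (constraints_pmf s m lam) T
           / (measure_pmf.expectation (constraints_pmf s m lam) T)\<^sup>2 \<le> B s m \<beta> d lam"
proof -
  have "pairwise (\<lambda>u v. d \<le> hamming_dist m u v) (models m \<phi>)"
    using assms(3) by (rule pairwiseI)
  moreover have "2 powr (real s + \<beta>) \<le> real (card (models m \<phi>))"
    using assms(8) by (simp add: num_models_def)
  ultimately have "(\<Sum>u\<in>models m \<phi>. \<Sum>v\<in>models m \<phi>. (1 + (1 - 2 * lam) ^ hamming_dist m u v) ^ s)
      / (real (num_models m \<phi>))\<^sup>2 - 1 \<le> B s m \<beta> d lam"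
    unfolding num_models_def using assms(2,6,7)
    by (intro average_over_pairs_le_B finite_models) auto
  moreover have "num_models m \<phi> > 0"
    using assms(8) by (auto intro: gr0I)
  ultimately show ?thesis
    unfolding assms(9) using assms(6,7) by (simp add: relative_variance_num_models)
qed

end
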